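(* Let $V$ be a euclidean space of dimension $n\ge2$, let $c(s)$ be a regular curve in $V$ parameterized by arclength (i.e. $\|c'(s)\|=1$ for all $s$), and let $\kappa_1(s),\dots,\kappa_{n-1}(s)$ be its curvatures. Then for $1\le r\le n-2$, $$\kappa_r=\frac{\mathrm{vol}(c',\dots,c^{(r-1)})\,\mathrm{vol}(c',\dots,c^{(r+1)})}{\mathrm{vol}(c',\dots,c^{(r)})^2}.$$ The top curvature satisfies $$\kappa_{n-1}=\frac{\mathrm{vol}(c',\dots,c^{(n-2)})}{\mathrm{vol}(c',\dots,c^{(n-1)})^2}\,\det\left(c',c'',\dots,c^{(n)}\right).$$
   Context: A euclidean space is a finite-dimensional, oriented, real vector space $V$ with a positive definite scalar product $\langle\cdot,\cdot\rangle$. A regular curve in $V$ ($\dim V=n$) is a map $c:[a,b]\to V$, $a<b$, which is differentiable as many times as needed and such that $c'(t),\dots,c^{(n-1)}(t)$ are linearly independent for every $t\in[a,b]$. $\mathrm{vol}(v_1,\dots,v_k)$ is the $k$-dimensional volume of the parallelepiped spanned by $v_1,\dots,v_k\in V$, i.e. the square root of the Gram determinant $\det(\langle v_i,v_j\rangle)$; the volume of the empty collection is $1$. $\det(v_1,\dots,v_n)$ is the determinant of the matrix of coordinates of $v_1,\dots,v_n$ in any positive orthonormal basis of $V$. Frenet-Serret frame $e=(e_1,\dots,e_n)$: $e_1,\dots,e_{n-1}$ is the Gram-Schmidt orthonormalization of $c',\dots,c^{(n-1)}$ (so $e_i$ is a linear combination of $c',\dots,c^{(i)}$ with positive coefficient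 at $c^{(i)}$), and $e_n$ is the unique vector making $e_1,\dots,e_n$ a positive orthonormal basis. The curvatures $\kappa_1,\dots,\kappa_{n-1}$ are determined by $e_i'=\|c'\|\,(-\kappa_{i-1}e_{i-1}+\kappa_i e_{i+1})$, $1\le i\le n$ (terms involving $e_0$ or $e_{n+1}$ are absent). *)

theory Defs
  imports "HOL-Analysis.Analysis" "Jordan_Normal_Form.Determinant"
begin

text \<open>The names \<open>det\<close> and \<open>mat\<close> exist both in HOL-Analysis (dimensions as types) and in
  Jordan_Normal_Form (dimensions as natural numbers). Gram matrices have varying size, so the
  Jordan_Normal_Form versions are used, always qualified.\<close>

definition vol :: "'a::real_inner list \<Rightarrow> real" where
  "vol vs = sqrt (Determinant.det
     (Matrix.mat (length vs) (length vs) (\<lambda>(i, j). vs ! i \<bullet> vs ! j)))"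

definition orthonormal :: "'a::real_inner list \<Rightarrow> bool" where
  "orthonormal vs \<longleftrightarrow>
     (\<forall>i<length vs. \<forall>j<length vs. vs ! i \<bullet> vs ! j = (if i = j then 1 else 0))"

text \<open>Linear independence of a finite family: repetitions count as dependence.\<close>

definition lin_indep :: "'a::real_vector list \<Rightarrow> bool" where
  "lin_indep vs \<longleftrightarrow> distinct vs \<and> independent (set vs)"

definition ordered_bases :: "'a::real_vector list set" where
  "ordered_bases = {bs. lin_indep bs \<and> span (set bs) = UNIV}"

text \<open>Column \<open>j\<close> holds the coordinates of the \<open>j\<close>-th vector of \<open>vs\<close> in the ordered basis \<open>bs\<close>.\<close>

definition coord_matrix :: "'a::real_vector list \<Rightarrow> 'a list \<Rightarrow> real Matrix.mat" where
  "coord_matrix bs vs = Matrix.mat (length bs) (length vs)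
     (\<lambda>(i, j). representation (set bs) (vs ! j) (bs ! i))"

definition same_orientation :: "('a::real_vector list \<times> 'a list) set" where
  "same_orientation = {(bs, cs). bs \<in> ordered_bases \<and> cs \<in> ordered_bases \<and>
     0 < Determinant.det (coord_matrix bs cs)}"

text \<open>An orientation is a class of equally oriented ordered bases; its members are the
  positive bases.\<close>

definition orientation :: "'a::real_vector list set \<Rightarrow> bool" where
  "orientation Or \<longleftrightarrow> Or \<in> ordered_bases // same_orientation"

text \<open>The value does not depend on the positive orthonormal basis \<open>bs\<close>; the description
  singles out this common value.\<close>

definition oriented_det :: "'a::real_inner list set \<Rightarrow> 'a list \<Rightarrow> real" where
  "oriented_det Or vs =
     (THE d. \<exists>bs\<in>Or. orthonormal bs \<and> d = Determinant.det (coord_matrix bs vs))"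

text \<open>The derivative of order \<open>k\<close> on the closed interval, one-sided at the end points.\<close>

definition nderiv :: "real \<Rightarrow> real \<Rightarrow> nat \<Rightarrow> (real \<Rightarrow> 'a::real_normed_vector) \<Rightarrow> real \<Rightarrow> 'a" where
  "nderiv a b k c = ((\<lambda>f t. vector_derivative f (at t within {a..b})) ^^ k) c"

text \<open>The list of the derivatives of orders \<open>1, \<dots>, k\<close>.\<close>

definition derivs ::
  "real \<Rightarrow> real \<Rightarrow> (real \<Rightarrow> 'a::real_normed_vector) \<Rightarrow> nat \<Rightarrow> real \<Rightarrow> 'a list" where
  "derivs a b c k t = map (\<lambda>i. nderiv a b i c t) [1..<Suc k]"

text \<open>Differentiability of order \<open>n = DIM('a)\<close> is what the Frenet frame equations and the
  derivative of order \<open>n\<close> need.\<close>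

definition regular_curve :: "real \<Rightarrow> real \<Rightarrow> (real \<Rightarrow> 'a::euclidean_space) \<Rightarrow> bool" where
  "regular_curve a b c \<longleftrightarrow> a < b \<and>
     (\<forall>k<DIM('a). \<forall>t\<in>{a..b}. nderiv a b k c differentiable (at t within {a..b})) \<and>
     (\<forall>t\<in>{a..b}. lin_indep (derivs a b c (DIM('a) - 1) t))"

text \<open>Gram-Schmidt orthonormalization of a sequence whose indices start at 1.\<close>

fun orthonormalization :: "(nat \<Rightarrow> 'a::real_inner) \<Rightarrow> nat \<Rightarrow> 'a" where
  "orthonormalization v i =
     (let w = v i - (\<Sum>j\<in>{1..<i}. (v i \<bullet> orthonormalization v j) *\<^sub>R orthonormalization v j)
      in w /\<^sub>R norm w)"

declare orthonormalization.simps [simp del]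

text \<open>The frame vectors are indexed by \<open>1, \<dots>, DIM('a)\<close>.\<close>

definition frenet_frame ::
  "'a::euclidean_space list set \<Rightarrow> real \<Rightarrow> real \<Rightarrow> (real \<Rightarrow> 'a) \<Rightarrow> nat \<Rightarrow> real \<Rightarrow> 'a" where
  "frenet_frame Or a b c i t =
     (let e = orthonormalization (\<lambda>k. nderiv a b k c t)
      in if i < DIM('a) then e i
         else (THE u. map e [1..<DIM('a)] @ [u] \<in> Or \<and> orthonormal (map e [1..<DIM('a)] @ [u])))"

definition frenet_curvatures ::
  "'a::euclidean_space list set \<Rightarrow> real \<Rightarrow> real \<Rightarrow> (real \<Rightarrow> 'a) \<Rightarrow> (nat \<Rightarrow> real \<Rightarrow> real) \<Rightarrow> bool" where
  "frenet_curvatures Or a b c \<kappa> \<longleftrightarrow>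
     (\<forall>t\<in>{a..b}. \<forall>i\<in>{1..DIM('a)}.
        (frenet_frame Or a b c i has_vector_derivative
           norm (nderiv a b 1 c t) *\<^sub>R
             ((if i = 1 then 0 else - \<kappa> (i - 1) t *\<^sub>R frenet_frame Or a b c (i - 1) t) +
              (if i = DIM('a) then 0 else \<kappa> i t *\<^sub>R frenet_frame Or a b c (i + 1) t)))
        (at t within {a..b}))"

end

theory Submission imports Defs begin

text \<open>Write \<open>e\<close> for the frame, \<open>v\<^sub>i\<close> for the derivative of order \<open>i\<close> and \<open>p\<^sub>i = v\<^sub>i \<bullet> e\<^sub>i\<close>.
  Differentiating \<open>v\<^sub>r \<bullet> e\<^sub>r\<^sub>+\<^sub>1 = 0\<close>, where \<open>v\<^sub>r\<close> lies in the span of \<open>e\<^sub>1, \<dots>, e\<^sub>r\<close>, and inserting the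
  Frenet equation for \<open>e\<^sub>r\<^sub>+\<^sub>1\<close> gives \<open>\<kappa>\<^sub>r = p\<^sub>r\<^sub>+\<^sub>1 / p\<^sub>r\<close>. The coordinates of the \<open>v\<^sub>i\<close> with respect to
  the frame form a triangular matrix with diagonal \<open>p\<^sub>i\<close>, so that the volumes and the determinant are
  products of the \<open>p\<^sub>i\<close>.\<close>

no_notation Matrix.scalar_prod (infix \<open>\<bullet>\<close> 70)

section \<open>Triangular determinants and orthonormal lists\<close>

lemma det_upper_triangular_prod:
  fixes f :: "nat \<Rightarrow> nat \<Rightarrow> real"
  assumes "\<And>i j. j < i \<Longrightarrow> i < n \<Longrightarrow> f i j = 0"
  shows "Determinant.det (Matrix.mat n n (\<lambda>(i, j). f i j)) = (\<Prod>i<n. f i i)"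
proof -
  have "upper_triangular (Matrix.mat n n (\<lambda>(i, j). f i j))"
    using assms by (auto simp: upper_triangular_def)
  then show ?thesis
    by (subst det_upper_triangular) (auto simp: prod_list_diag_prod lessThan_atLeast0)
qed

text \<open>The vectors that satisfy the expansion form a subspace, and orthonormality puts every
  member of \<open>es\<close> into it.\<close>

lemma orthonormal_expansion:
  assumes "orthonormal es" "x \<in> span (set es)"
  shows "x = (\<Sum>i<length es. (x \<bullet> es ! i) *\<^sub>R es ! i)"
  using assms(2)
proof (induction rule: span_induct)
  case base
  show ?case
  proof (rule subspaceI; unfold mem_Collect_eq)
    fix c x
    assume "x = (\<Sum>i<length es. (x \<bullet> es ! i) *\<^sub>R es ! i)"
    then have "c *\<^sub>R x = c *\<^sub>R (\<Sum>i<length es. (x \<bullet> es ! i) *\<^sub>R es ! i)" by (rule arg_cong)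
    also have "\<dots> = (\<Sum>i<length es. (c *\<^sub>R x \<bullet> es ! i) *\<^sub>R es ! i)"
      by (simp add: scaleR_sum_right)
    finally show "c *\<^sub>R x = (\<Sum>i<length es. (c *\<^sub>R x \<bullet> es ! i) *\<^sub>R es ! i)" .
  qed (simp_all add: inner_add_left sum.distrib scaleR_add_left)
next
  case (step x)
  then obtain k where k: "k < length es" "x = es ! k" by (auto simp: in_set_conv_nth)
  have "(\<Sum>i<length es. (x \<bullet> es ! i) *\<^sub>R es ! i) = (\<Sum>i<length es. if k = i then es ! i else 0)"
    using assms(1) k by (intro sum.cong) (auto simp: orthonormal_def)
  with k show ?case by simp
qed

lemma orthonormal_lin_indep:
  assumes "orthonormal es"
  shows "lin_indep es"
proof -
  have "distinct es"
    using assms unfolding distinct_conv_nth orthonormal_def by (metis zero_neq_one)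
  moreover have "independent (set es)"
  proof (rule pairwise_orthogonal_independent)
    show "pairwise Linear_Algebra.orthogonal (set es)"
      using assms unfolding pairwise_def Linear_Algebra.orthogonal_def orthonormal_def by (metis in_set_conv_nth)
    show "0 \<notin> set es"
      using assms unfolding orthonormal_def by (metis in_set_conv_nth inner_zero_left zero_neq_one)
  qed
  ultimately show ?thesis by (simp add: lin_indep_def)
qed

section \<open>Ordered bases and change of coordinates\<close>

lemma length_ordered_basis:
  fixes bs :: "'a::euclidean_space list"
  assumes "bs \<in> ordered_bases"
  shows "length bs = DIM('a)"
  using assms unfolding ordered_bases_def lin_indep_def
  by (metis (mono_tags, lifting) dim_UNIV dim_span_eq_card_independent distinct_card mem_Collect_eq)

lemma orthonormal_ordered_basis:
  fixes es :: "'a::euclidean_space list"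
  assumes "orthonormal es" "length es = DIM('a)"
  shows "es \<in> ordered_bases"
proof -
  have li: "lin_indep es" using orthonormal_lin_indep[OF assms(1)] .
  then have "dim (set es) = DIM('a)"
    using assms(2) by (simp add: lin_indep_def dim_eq_card_independent distinct_card)
  then show ?thesis using li by (simp add: ordered_bases_def dim_eq_full)
qed

lemma ordered_basis_expansion:
  assumes "bs \<in> ordered_bases"
  shows "(\<Sum>i<length bs. representation (set bs) x (bs ! i) *\<^sub>R bs ! i) = x"
proof -
  have bs: "distinct bs" "independent (set bs)" "span (set bs) = UNIV"
    using assms by (auto simp: ordered_bases_def lin_indep_def)
  have "(\<Sum>b\<in>set bs. representation (set bs) x b *\<^sub>R b) = x"
    using bs by (intro sum_representation_eq) auto
  moreover have "bij_betw ((!) bs) {..<length bs} (set bs)"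
    using bs(1) by (auto intro: bij_betw_nth)
  ultimately show ?thesis
    by (simp add: sum.reindex_bij_betw[where g = "\<lambda>b. representation (set bs) x b *\<^sub>R b"])
qed

text \<open>Expanding \<open>vs ! j\<close> in \<open>cs\<close> and using linearity of the
  coordinates with respect to \<open>bs\<close> gives exactly the entries of the matrix
  product.\<close>

lemma coord_matrix_mult:
  fixes bs cs vs :: "'a::euclidean_space list"
  assumes bs: "bs \<in> ordered_bases" and cs: "cs \<in> ordered_bases"
  shows "coord_matrix bs vs = coord_matrix bs cs * coord_matrix cs vs"
proof (rule eq_matI)
  fix i j
  assume "i < dim_row (coord_matrix bs cs * coord_matrix cs vs)"
    and "j < dim_col (coord_matrix bs cs * coord_matrix cs vs)"
  then have ij: "i < length bs" "j < length vs" by (auto simp: coord_matrix_def)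
  have ind: "independent (set bs)" and UN: "\<And>x. x \<in> span (set bs)"
    using bs by (auto simp: ordered_bases_def lin_indep_def)
  have "representation (set bs) (vs ! j) (bs ! i) = representation (set bs)
      (\<Sum>k<length cs. representation (set cs) (vs ! j) (cs ! k) *\<^sub>R cs ! k) (bs ! i)"
    by (simp add: ordered_basis_expansion[OF cs])
  also have "\<dots> = (\<Sum>k<length cs. representation (set bs) (cs ! k) (bs ! i)
      * representation (set cs) (vs ! j) (cs ! k))"
    by (simp add: representation_sum[OF ind UN] representation_scale[OF ind UN] mult.commute)
  finally show "coord_matrix bs vs $$ (i, j) = (coord_matrix bs cs * coord_matrix cs vs) $$ (i, j)"
    using ij by (simp add: coord_matrix_def scalar_prod_def lessThan_atLeast0)
qed (auto simp: coord_matrix_def)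

lemma det_coord_matrix_mult:
  fixes bs cs vs :: "'a::euclidean_space list"
  assumes "bs \<in> ordered_bases" "cs \<in> ordered_bases" "length vs = DIM('a)"
  shows "Determinant.det (coord_matrix bs vs) =
    Determinant.det (coord_matrix bs cs) * Determinant.det (coord_matrix cs vs)"
proof -
  have "coord_matrix bs cs \<in> carrier_mat (DIM('a)) (DIM('a))"
    "coord_matrix cs vs \<in> carrier_mat (DIM('a)) (DIM('a))"
    using assms length_ordered_basis[of bs] length_ordered_basis[of cs]
    by (auto simp: coord_matrix_def)
  then show ?thesis
    using det_mult coord_matrix_mult[OF assms(1,2)] by metis
qed

lemma representation_orthonormal:
  assumes "orthonormal es" "es \<in> ordered_bases" "i < length es"
  shows "representation (set es) x (es ! i) = x \<bullet> es ! i"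
proof -
  have "x \<bullet> es ! i = (\<Sum>k<length es. representation (set es) x (es ! k) *\<^sub>R es ! k) \<bullet> es ! i"
    by (simp add: ordered_basis_expansion[OF assms(2)])
  also have "\<dots> = (\<Sum>k<length es. if i = k then representation (set es) x (es ! k) else 0)"
    using assms unfolding inner_sum_left
    by (intro sum.cong) (auto simp: orthonormal_def)
  finally show ?thesis using assms(3) by simp
qed

lemma coord_matrix_orthonormal:
  fixes es :: "'a::euclidean_space list"
  assumes "orthonormal es" "length es = DIM('a)"
  shows "coord_matrix es vs = Matrix.mat (length es) (length vs) (\<lambda>(i, j). vs ! j \<bullet> es ! i)"
  unfolding coord_matrix_def
  using representation_orthonormal[OF assms(1) orthonormal_ordered_basis[OF assms]]
  by (intro cong_mat) auto

lemma det_coord_matrix_self: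
  fixes bs :: "'a::euclidean_space list"
  assumes "bs \<in> ordered_bases"
  shows "Determinant.det (coord_matrix bs bs) = 1"
proof -
  have "coord_matrix bs bs = 1\<^sub>m (length bs)"
    using assms
    by (intro eq_matI)
      (auto simp: coord_matrix_def representation_basis ordered_bases_def lin_indep_def
        nth_eq_iff_index_eq)
  then show ?thesis by simp
qed

text \<open>The two coordinate matrices between orthonormal bases are transposes of each other, and
  the product of their determinants is 1. The sign that remains open is decided by the
  orientation.\<close>

lemma det_coord_matrix_orthonormal_square:
  fixes es fs :: "'a::euclidean_space list"
  assumes es: "orthonormal es" "length es = DIM('a)" and fs: "orthonormal fs" "length fs = DIM('a)"
  shows "(Determinant.det (coord_matrix es fs))\<^sup>2 = 1"
proof -
  have "coord_matrix fs es = transpose_mat (coord_matrix es fs)"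
    using es fs by (intro eq_matI) (auto simp: coord_matrix_orthonormal inner_commute)
  moreover have "coord_matrix es fs \<in> carrier_mat (DIM('a)) (DIM('a))"
    using es fs by (simp add: coord_matrix_def)
  ultimately have "Determinant.det (coord_matrix fs es) = Determinant.det (coord_matrix es fs)"
    using det_transpose by metis
  then show ?thesis
    using det_coord_matrix_mult[of es fs es] det_coord_matrix_self[of es] es fs
    by (simp add: orthonormal_ordered_basis power2_eq_square)
qed

section \<open>Orientations and the oriented determinant\<close>

lemma orientation_subset: "orientation Or \<Longrightarrow> Or \<subseteq> ordered_bases"
  by (auto simp: orientation_def quotient_def same_orientation_def)

lemma det_coord_matrix_nonzero:
  fixes bs cs :: "'a::euclidean_space list"
  assumes "bs \<in> ordered_bases" "cs \<in> ordered_bases"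
  shows "Determinant.det (coord_matrix bs cs) \<noteq> 0"
  using det_coord_matrix_mult[of bs cs bs] det_coord_matrix_self[of bs] assms
  by (auto simp: length_ordered_basis)

text \<open>Any member of the class can serve as the reference basis: going from the representative
  \<open>bs\<close> to \<open>es\<close> changes the determinant only by a positive factor.\<close>

lemma same_orientation_iff:
  fixes Or :: "'a::euclidean_space list set"
  assumes "orientation Or" "es \<in> Or"
  shows "fs \<in> Or \<longleftrightarrow> fs \<in> ordered_bases \<and> 0 < Determinant.det (coord_matrix es fs)"
proof -
  obtain bs where bs: "bs \<in> ordered_bases" and Or: "Or = same_orientation `` {bs}"
    using assms(1) by (auto simp: orientation_def quotient_def)
  have es: "es \<in> ordered_bases" "0 < Determinant.det (coord_matrix bs es)"
    using assms(2) unfolding Or by (simp_all add: same_orientation_def)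
  have "fs \<in> Or \<longleftrightarrow> fs \<in> ordered_bases \<and> 0 < Determinant.det (coord_matrix bs fs)"
    using bs unfolding Or by (simp add: same_orientation_def)
  also have "\<dots> \<longleftrightarrow> fs \<in> ordered_bases \<and> 0 < Determinant.det (coord_matrix es fs)"
    using det_coord_matrix_mult[OF bs es(1) length_ordered_basis[of fs]] es(2)
    by (metis zero_less_mult_pos mult_pos_pos)
  finally show ?thesis .
qed

lemma det_coord_matrix_orthonormal_positive:
  fixes Or :: "'a::euclidean_space list set"
  assumes Or: "orientation Or" and es: "orthonormal es" "es \<in> Or" and fs: "orthonormal fs" "fs \<in> Or"
  shows "Determinant.det (coord_matrix es fs) = 1"
proof -
  have "length es = DIM('a)" "length fs = DIM('a)"
    using assms orientation_subset length_ordered_basis by blast+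
  then have "(Determinant.det (coord_matrix es fs))\<^sup>2 = 1"
    using det_coord_matrix_orthonormal_square es fs by blast
  moreover have "0 < Determinant.det (coord_matrix es fs)"
    using same_orientation_iff[OF Or es(2)] fs by blast
  ultimately show ?thesis by (simp add: power2_eq_1_iff)
qed

text \<open>Passing from one positive orthonormal basis to another multiplies the determinant by 1,
  so the definite description has exactly one candidate. This permits the evaluation in the Frenet
  frame.\<close>

lemma oriented_det_eq:
  fixes Or :: "'a::euclidean_space list set"
  assumes Or: "orientation Or" and es: "orthonormal es" "es \<in> Or" and vs: "length vs = DIM('a)"
  shows "oriented_det Or vs = Determinant.det (coord_matrix es vs)"
proof -
  have "Determinant.det (coord_matrix fs vs) = Determinant.det (coord_matrix es vs)"
    if fs: "fs \<in> Or" "orthonormal fs" for fs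
  proof -
    have "fs \<in> ordered_bases" "es \<in> ordered_bases"
      using orientation_subset[OF Or] fs es by blast+
    from det_coord_matrix_mult[OF this vs] show ?thesis
      using det_coord_matrix_orthonormal_positive[OF Or fs(2,1) es] by simp
  qed
  then show ?thesis unfolding oriented_det_def using es by (intro the_equality) blast+
qed

text \<open>The coordinate matrix differs from the identity only in its last column, so it is upper
  triangular and its last diagonal entry is the determinant. Existence and uniqueness of the last
  frame vector both rest on this value.\<close>

lemma det_coord_matrix_append_last:
  fixes es :: "'a::euclidean_space list"
  assumes "orthonormal (es @ [u])" "Suc (length es) = DIM('a)"
  shows "Determinant.det (coord_matrix (es @ [u]) (es @ [w])) = w \<bullet> u"
proof -
  let ?m = "length es"
  have "coord_matrix (es @ [u]) (es @ [w]) =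
      Matrix.mat (Suc ?m) (Suc ?m) (\<lambda>(i, j). (es @ [w]) ! j \<bullet> (es @ [u]) ! i)"
    using assms by (simp add: coord_matrix_orthonormal)
  also have "Determinant.det \<dots> = (\<Prod>i<Suc ?m. (es @ [w]) ! i \<bullet> (es @ [u]) ! i)"
  proof (rule det_upper_triangular_prod)
    fix i j assume "j < i" "i < Suc ?m"
    moreover from this have "(es @ [w]) ! j = (es @ [u]) ! j" by (simp add: nth_append)
    ultimately show "(es @ [w]) ! j \<bullet> (es @ [u]) ! i = 0"
      using assms(1) by (simp add: orthonormal_def)
  qed
  also have "\<dots> = (\<Prod>i<?m. (es @ [u]) ! i \<bullet> (es @ [u]) ! i) * (w \<bullet> u)"
    by (simp add: nth_append)
  also have "(\<Prod>i<?m. (es @ [u]) ! i \<bullet> (es @ [u]) ! i) = 1"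
    using assms(1) by (intro prod.neutral) (simp add: orthonormal_def)
  finally show ?thesis by simp
qed

section \<open>Completion to a positive orthonormal basis\<close>

lemma orthonormal_append_iff:
  "orthonormal (es @ [u]) \<longleftrightarrow> orthonormal es \<and> u \<bullet> u = 1 \<and> (\<forall>e\<in>set es. e \<bullet> u = 0)"
  by (auto simp: orthonormal_def nth_append less_Suc_eq all_set_conv_all_nth inner_commute)

text \<open>Existence: for a unit normal \<open>u\<close> of the span, the choices \<open>u\<close>
  and \<open>-u\<close> have opposite nonzero determinants, so one of them is positive. Uniqueness:
  for two positive completions the transition determinant is \<open>z \<bullet> w = 1\<close>, which
  forces equality of unit vectors.\<close>

lemma ex1_positive_completion:
  fixes Or :: "'a::euclidean_space list set"
  assumes Or: "orientation Or" and es: "orthonormal es" "Suc (length es) = DIM('a)"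
  shows "\<exists>!u. es @ [u] \<in> Or \<and> orthonormal (es @ [u])"
proof -
  have "dim (set es) < DIM('a)"
    using orthonormal_lin_indep[OF es(1)] es(2)
    by (simp add: lin_indep_def dim_eq_card_independent distinct_card)
  then obtain x where x: "x \<noteq> 0" "\<And>y. y \<in> span (set es) \<Longrightarrow> Linear_Algebra.orthogonal x y"
    using orthogonal_to_subspace_exists by metis
  define u where "u = x /\<^sub>R norm x"
  have on: "orthonormal (es @ [u])"
    unfolding orthonormal_append_iff using es(1) x
    by (auto simp: u_def Linear_Algebra.orthogonal_def span_base inner_commute power2_norm_eq_inner[symmetric]
        power2_eq_square field_simps)
  then have on': "orthonormal (es @ [-u])" by (simp add: orthonormal_append_iff)
  obtain bs where bs: "bs \<in> ordered_bases" and Or': "Or = same_orientation `` {bs}"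
    using assms(1) by (auto simp: orientation_def quotient_def)
  have ob: "es @ [u] \<in> ordered_bases" "es @ [-u] \<in> ordered_bases"
    using on on' es(2) by (auto intro!: orthonormal_ordered_basis)
  have "Determinant.det (coord_matrix bs (es @ [-u])) = - Determinant.det (coord_matrix bs (es @ [u]))"
    using det_coord_matrix_mult[OF bs ob(1), of "es @ [-u]"] es(2) on
      det_coord_matrix_append_last[OF on es(2), of "-u"]
    by (simp add: orthonormal_append_iff)
  then have "es @ [u] \<in> Or \<or> es @ [-u] \<in> Or"
    using bs ob det_coord_matrix_nonzero[OF bs ob(1)] by (auto simp: Or' same_orientation_def)
  then obtain w where w: "es @ [w] \<in> Or" "orthonormal (es @ [w])" using on on' by blast
  show ?thesis
  proof (rule ex1I)
    show "es @ [w] \<in> Or \<and> orthonormal (es @ [w])" using w by simp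
    fix z assume z: "es @ [z] \<in> Or \<and> orthonormal (es @ [z])"
    then have "z \<bullet> w = 1"
      using det_coord_matrix_append_last[OF w(2) es(2), of z]
        det_coord_matrix_orthonormal_positive[OF Or w(2,1)] by simp
    moreover have "z \<bullet> z = 1" "w \<bullet> w = 1" using z w by (auto simp: orthonormal_append_iff)
    ultimately have "(z - w) \<bullet> (z - w) = 0" by (simp add: inner_diff inner_commute)
    then show "z = w" by simp
  qed
qed

section \<open>Volumes and determinants in a triangular frame\<close>

lemma orthonormal_map_iff:
  "orthonormal (map e [1..<Suc k]) \<longleftrightarrow>
    (\<forall>i\<in>{1..k}. \<forall>j\<in>{1..k}. e i \<bullet> e j = (if i = j then 1 else 0))"
proof -
  have "orthonormal (map e [1..<Suc k]) \<longleftrightarrow>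
      (\<forall>i\<in>{..<k}. \<forall>j\<in>{..<k}. e (Suc i) \<bullet> e (Suc j) = (if Suc i = Suc j then 1 else 0))"
    by (auto simp: orthonormal_def simp del: upt_Suc)
  also have "\<dots> \<longleftrightarrow>
      (\<forall>i\<in>Suc ` {..<k}. \<forall>j\<in>Suc ` {..<k}. e i \<bullet> e j = (if i = j then 1 else 0))"
    by simp
  also have "Suc ` {..<k} = {1..k}" by (simp add: image_Suc_lessThan)
  finally show ?thesis .
qed

text \<open>Supplies the zeros below the diagonal of the coordinate matrices, and later the
  orthogonality relation that is differentiated to find the curvatures.\<close>

lemma inner_span_orthonormal_eq_0:
  assumes "orthonormal (map e [1..<Suc k])" "x \<in> span (e ` {1..i})" "i < j" "j \<le> k"
  shows "x \<bullet> e j = 0"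
proof -
  have "Linear_Algebra.orthogonal (e j) x"
    using assms(2)
  proof (rule orthogonal_to_span)
    show "Linear_Algebra.orthogonal (e j) y" if "y \<in> e ` {1..i}" for y
      using assms(1,3,4) that unfolding orthonormal_map_iff Linear_Algebra.orthogonal_def by auto
  qed
  then show ?thesis by (simp add: Linear_Algebra.orthogonal_def inner_commute)
qed

text \<open>The Gram matrix is the transpose of \<open>?M\<close> times \<open>?M\<close>, where the
  square matrix \<open>?M\<close> holds the coordinates with respect to \<open>e\<close>. Its
  determinant is therefore the square of the diagonal product, and the square root leaves the
  absolute value.\<close>

lemma vol_triangular:
  assumes on: "orthonormal (map e [1..<Suc k])" and v: "\<And>i. i \<in> {1..k} \<Longrightarrow> v i \<in> span (e ` {1..i})"
  shows "vol (map v [1..<Suc k]) = \<bar>\<Prod>i=1..k. v i \<bullet> e i\<bar>"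
proof -
  let ?M = "Matrix.mat k k (\<lambda>(i, j). v (Suc j) \<bullet> e (Suc i))"
  have expand: "v i \<bullet> y = (\<Sum>l<k. (v i \<bullet> e (Suc l)) * (e (Suc l) \<bullet> y))" if "i \<in> {1..k}" for i y
  proof -
    have "v i \<in> span (set (map e [1..<Suc k]))"
      using v[OF that] span_mono[of "e ` {1..i}" "set (map e [1..<Suc k])"] that
      by (force simp del: upt_Suc)
    from orthonormal_expansion[OF on this]
    have "v i = (\<Sum>l<k. (v i \<bullet> e (Suc l)) *\<^sub>R e (Suc l))"
      by (simp del: upt_Suc)
    then have "v i \<bullet> y = (\<Sum>l<k. (v i \<bullet> e (Suc l)) *\<^sub>R e (Suc l)) \<bullet> y" by (rule arg_cong)
    then show ?thesis by (simp add: inner_sum_left)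
  qed
  have "Matrix.mat k k (\<lambda>(i, j). map v [1..<Suc k] ! i \<bullet> map v [1..<Suc k] ! j)
      = transpose_mat ?M * ?M"
  proof (rule eq_matI)
    fix i j assume "i < dim_row (transpose_mat ?M * ?M)" "j < dim_col (transpose_mat ?M * ?M)"
    then have ij: "i < k" "j < k" by auto
    have "(transpose_mat ?M * ?M) $$ (i, j) =
        (\<Sum>l<k. (v (Suc i) \<bullet> e (Suc l)) * (e (Suc l) \<bullet> v (Suc j)))"
      using ij by (simp add: scalar_prod_def lessThan_atLeast0 inner_commute[of "e _"])
    also have "\<dots> = v (Suc i) \<bullet> v (Suc j)"
      using expand[of "Suc i" "v (Suc j)"] ij by simp
    finally show "Matrix.mat k k (\<lambda>(i, j). map v [1..<Suc k] ! i \<bullet> map v [1..<Suc k] ! j) $$ (i, j)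
        = (transpose_mat ?M * ?M) $$ (i, j)"
      using ij by (simp del: upt_Suc)
  qed auto
  then have "vol (map v [1..<Suc k]) = sqrt ((Determinant.det ?M)\<^sup>2)"
    using det_mult[of "transpose_mat ?M" k ?M] det_transpose[of ?M k]
    by (simp add: vol_def power2_eq_square del: upt_Suc)
  also have "Determinant.det ?M = (\<Prod>i<k. v (Suc i) \<bullet> e (Suc i))"
  proof (rule det_upper_triangular_prod)
    show "v (Suc j) \<bullet> e (Suc i) = 0" if "j < i" "i < k" for i j
      using inner_span_orthonormal_eq_0[OF on v[of "Suc j"], of "Suc i"] that by simp
  qed
  also have "\<dots> = (\<Prod>i=1..k. v i \<bullet> e i)"
    using prod.atLeast1_atMost_eq[of "\<lambda>i. v i \<bullet> e i" k] by simp
  finally show ?thesis by simp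
qed

text \<open>The last vector is exempt from the span condition because its column has no entry below
  the diagonal. This admits the derivative of order \<open>DIM('a)\<close>, which does not take part
  in the Gram-Schmidt process.\<close>

lemma det_coord_matrix_triangular:
  fixes e v :: "nat \<Rightarrow> 'a::euclidean_space"
  assumes on: "orthonormal (map e [1..<Suc (DIM('a))])"
    and v: "\<And>i. i \<in> {1..<DIM('a)} \<Longrightarrow> v i \<in> span (e ` {1..i})"
  shows "Determinant.det (coord_matrix (map e [1..<Suc (DIM('a))]) (map v [1..<Suc (DIM('a))])) =
    (\<Prod>i=1..DIM('a). v i \<bullet> e i)"
proof -
  let ?n = "DIM('a)"
  have "coord_matrix (map e [1..<Suc ?n]) (map v [1..<Suc ?n]) =
      Matrix.mat ?n ?n (\<lambda>(i, j). v (Suc j) \<bullet> e (Suc i))"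
    using coord_matrix_orthonormal[OF on] by (auto intro!: cong_mat simp del: upt_Suc)
  also have "Determinant.det \<dots> = (\<Prod>i<?n. v (Suc i) \<bullet> e (Suc i))"
  proof (rule det_upper_triangular_prod)
    show "v (Suc j) \<bullet> e (Suc i) = 0" if "j < i" "i < ?n" for i j
      using inner_span_orthonormal_eq_0[OF on v[of "Suc j"], of "Suc i"] that by simp
  qed
  also have "\<dots> = (\<Prod>i=1..?n. v i \<bullet> e i)"
    using prod.atLeast1_atMost_eq[of "\<lambda>i. v i \<bullet> e i" ?n] by simp
  finally show ?thesis .
qed

section \<open>Gram-Schmidt and the Frenet frame\<close>

lemma orthonormalization_properties:
  assumes li: "lin_indep (map v [1..<Suc m])" and "k \<le> m"
  defines "e \<equiv> orthonormalization v"
  shows "orthonormal (map e [1..<Suc k]) \<and>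
    (\<forall>i\<in>{1..k}. v i \<in> span (e ` {1..i}) \<and> e i \<in> span (v ` {1..i}) \<and> 0 < v i \<bullet> e i)"
  using \<open>k \<le> m\<close>
proof (induction k)
  case 0
  show ?case by (simp add: orthonormal_def)
next
  case (Suc k)
  then have on: "orthonormal (map e [1..<Suc k])"
    and IH: "\<And>i. i \<in> {1..k} \<Longrightarrow> v i \<in> span (e ` {1..i}) \<and> e i \<in> span (v ` {1..i}) \<and> 0 < v i \<bullet> e i"
    by auto
  \<comment> \<open>\<open>q\<close> is the orthogonal projection of the new vector to the span of
    the earlier frame vectors, and \<open>w\<close> is the residual to be normalized.\<close>
  define q where "q = (\<Sum>j\<in>{1..k}. (v (Suc k) \<bullet> e j) *\<^sub>R e j)"
  define w where "w = v (Suc k) - q"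
  have eSuc: "e (Suc k) = w /\<^sub>R norm w"
    unfolding e_def
    by (subst orthonormalization.simps)
      (simp add: w_def q_def e_def Let_def atLeastLessThanSuc_atLeastAtMost)
  \<comment> \<open>The induction claim that \<open>e i\<close> is a combination of
    \<open>v 1, ..., v i\<close> serves here: it places \<open>q\<close> in the span of the earlier
    \<open>v i\<close>, so that linear independence yields \<open>w \<noteq> 0\<close>.\<close>
  have "e i \<in> span (v ` {1..k})" if "i \<in> {1..k}" for i
  proof -
    have "span (v ` {1..i}) \<subseteq> span (v ` {1..k})"
      using that by (intro span_mono image_mono) auto
    then show ?thesis using IH[OF that] by blast
  qed
  then have q: "q \<in> span (v ` {1..k})"
    unfolding q_def by (intro span_sum span_scale)
  have inj: "inj_on v {1..<Suc m}" and ind: "independent (v ` {1..<Suc m})"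
    using li by (auto simp: lin_indep_def distinct_map simp del: upt_Suc)
  have "v (Suc k) \<notin> span (v ` {1..k})"
  proof
    assume "v (Suc k) \<in> span (v ` {1..k})"
    \<comment> \<open>Injectivity of \<open>v\<close> ensures that deleting the value
      \<open>v (Suc k)\<close> deletes none of the earlier vectors.\<close>
    moreover have "v ` {1..k} \<subseteq> v ` {1..<Suc m} - {v (Suc k)}"
      using Suc.prems inj_onD[OF inj] by force
    ultimately have "v (Suc k) \<in> span (v ` {1..<Suc m} - {v (Suc k)})"
      using span_mono by blast
    then show False
      using ind Suc.prems by (auto simp: dependent_def)
  qed
  then have w0: "w \<noteq> 0" using q by (auto simp: w_def)
  have we: "w \<bullet> e i = 0" if "i \<in> {1..k}" for i
  proof -
    have "q \<bullet> e i = (\<Sum>j\<in>{1..k}. if i = j then v (Suc k) \<bullet> e j else 0)"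
      using on that unfolding q_def inner_sum_left orthonormal_map_iff
      by (intro sum.cong) auto
    then show ?thesis using that by (simp add: w_def inner_diff_left)
  qed
  have on': "orthonormal (map e [1..<Suc (Suc k)])"
  proof -
    have "e (Suc k) \<bullet> e (Suc k) = 1"
      using w0 by (simp add: eSuc power2_norm_eq_inner[symmetric] power2_eq_square)
    moreover have "e i \<bullet> e (Suc k) = 0" if "i \<in> {1..k}" for i
      using we[OF that] by (simp add: eSuc inner_commute)
    ultimately have "orthonormal (map e [1..<Suc k] @ [e (Suc k)])"
      using on unfolding orthonormal_append_iff by (auto simp del: upt_Suc)
    then show ?thesis by simp
  qed
  \<comment> \<open>This decomposition gives the span condition, and also positivity: the inner
    product with \<open>e (Suc k)\<close> is \<open>norm w\<close>.\<close>
  have v_eq: "v (Suc k) = norm w *\<^sub>R e (Suc k) + q"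
    using w0 by (simp add: eSuc w_def)
  have mono: "span (f ` {1..k}) \<subseteq> span (f ` {1..Suc k})" for f :: "nat \<Rightarrow> 'a"
    by (intro span_mono image_mono) auto
  have qe: "q \<in> span (e ` {1..k})"
    unfolding q_def by (intro span_sum span_scale span_base) auto
  have "v (Suc k) \<in> span (e ` {1..Suc k})"
    unfolding v_eq using qe mono by (intro span_add span_scale) (auto intro: span_base)
  moreover have "0 < v (Suc k) \<bullet> e (Suc k)"
    using on' w0 inner_span_orthonormal_eq_0[OF on' qe, of "Suc k"]
    unfolding v_eq orthonormal_map_iff by (simp add: inner_add_left)
  moreover have "e (Suc k) \<in> span (v ` {1..Suc k})"
    unfolding eSuc w_def using q mono by (intro span_scale span_diff) (auto intro: span_base)
  ultimately show ?case
    using on' IH by (auto simp: le_Suc_eq simp del: upt_Suc)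
qed

text \<open>Gram-Schmidt provides all vectors but the last, and the unique positive completion gives
  the description of the last one a meaning. What follows uses the frame only through these four
  facts and the Frenet equations.\<close>

lemma frenet_frame_properties:
  fixes c :: "real \<Rightarrow> 'a::euclidean_space"
  assumes Or: "orientation Or" and reg: "regular_curve a b c" and t: "t \<in> {a..b}"
  defines "e \<equiv> \<lambda>i. frenet_frame Or a b c i t"
  shows "map e [1..<Suc (DIM('a))] \<in> Or" "orthonormal (map e [1..<Suc (DIM('a))])"
    and "\<And>i. i \<in> {1..<DIM('a)} \<Longrightarrow> nderiv a b i c t \<in> span (e ` {1..i})"
    and "\<And>i. i \<in> {1..<DIM('a)} \<Longrightarrow> 0 < nderiv a b i c t \<bullet> e i"
proof -
  obtain m where m: "DIM('a) = Suc m" using DIM_positive[where 'a = 'a] gr0_implies_Suc by blast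
  define v where "v = (\<lambda>i. nderiv a b i c t)"
  let ?g = "orthonormalization v"
  have "lin_indep (map v [1..<Suc m])"
    using reg t m unfolding regular_curve_def derivs_def v_def by simp
  note gs = orthonormalization_properties[OF this order_refl]
  have e: "e i = ?g i" if "i < Suc m" for i
    using that by (simp add: e_def frenet_frame_def m v_def)
  have "\<exists>!u. map ?g [1..<Suc m] @ [u] \<in> Or \<and> orthonormal (map ?g [1..<Suc m] @ [u])"
    using gs m by (intro ex1_positive_completion[OF Or]) (auto simp del: upt_Suc)
  then have "map ?g [1..<Suc m] @ [e (Suc m)] \<in> Or \<and> orthonormal (map ?g [1..<Suc m] @ [e (Suc m)])"
    unfolding e_def frenet_frame_def m Let_def v_def
    by (simp del: upt_Suc) (rule theI')
  moreover have "map e [1..<Suc (DIM('a))] = map ?g [1..<Suc m] @ [e (Suc m)]"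
  proof -
    have "map e [1..<Suc m] = map ?g [1..<Suc m]" using e by (intro map_cong) auto
    then show ?thesis by (simp add: m)
  qed
  ultimately show "map e [1..<Suc (DIM('a))] \<in> Or" "orthonormal (map e [1..<Suc (DIM('a))])"
    by simp_all
  fix i assume i: "i \<in> {1..<DIM('a)}"
  have "e ` {1..i} = ?g ` {1..i}" using i e m by (intro image_cong) auto
  then show "nderiv a b i c t \<in> span (e ` {1..i})" "0 < nderiv a b i c t \<bullet> e i"
    using gs i e m by (auto simp: v_def)
qed

section \<open>Curvatures as quotients, and the final formulas\<close>

lemma curvature_eq:
  fixes c :: "real \<Rightarrow> 'a::euclidean_space"
  assumes Or: "orientation Or" and reg: "regular_curve a b c"
    and unit: "\<forall>s\<in>{a..b}. norm (nderiv a b 1 c s) = 1"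
    and fr: "frenet_curvatures Or a b c \<kappa>" and s: "s \<in> {a..b}" and r: "r \<in> {1..<DIM('a)}"
  defines "p \<equiv> \<lambda>i. nderiv a b i c s \<bullet> frenet_frame Or a b c i s"
  shows "\<kappa> r s = p (Suc r) / p r"
proof -
  let ?n = "DIM('a)" and ?e = "frenet_frame Or a b c" and ?F = "at s within {a..b}"
  \<comment> \<open>The Frenet derivative of \<open>?e (Suc r)\<close> at unit speed. The index is
    at least 2, so the backward term is always present; the forward term vanishes for
    \<open>Suc r = ?n\<close>, which lets one argument cover the top curvature too.\<close>
  let ?D = "(- \<kappa> r s *\<^sub>R ?e r s) + (if Suc r = ?n then 0 else \<kappa> (Suc r) s *\<^sub>R ?e (Suc (Suc r)) s)"
  have ab: "a < b" using reg by (simp add: regular_curve_def)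
  note frame = frenet_frame_properties[OF Or reg]
  have "nderiv a b r c differentiable ?F"
    using reg r s by (auto simp: regular_curve_def)
  then have "(nderiv a b r c has_vector_derivative nderiv a b (Suc r) c s) ?F"
    by (simp add: vector_derivative_works nderiv_def)
  moreover have "(?e (Suc r) has_vector_derivative ?D) ?F"
    using fr[unfolded frenet_curvatures_def, rule_format, OF s, of "Suc r"] unit s r
    by (simp split del: if_split cong: if_cong)
  ultimately have der: "((\<lambda>t. nderiv a b r c t \<bullet> ?e (Suc r) t) has_vector_derivative
      (nderiv a b r c s \<bullet> ?D + nderiv a b (Suc r) c s \<bullet> ?e (Suc r) s)) ?F"
    by (rule bounded_bilinear.has_vector_derivative[OF bounded_bilinear_inner])
  have zero: "nderiv a b r c t \<bullet> ?e j t = 0" if "t \<in> {a..b}" "r < j" "j \<le> ?n" for t j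
    using inner_span_orthonormal_eq_0[OF frame(2,3)[OF that(1)]] that r by blast
  have der0: "((\<lambda>t. nderiv a b r c t \<bullet> ?e (Suc r) t) has_vector_derivative 0) ?F"
    by (rule has_vector_derivative_transform[of _ _ _ "\<lambda>_. 0"]) (use s r zero in auto)
  \<comment> \<open>Since \<open>a < b\<close>, no point of the closed interval is isolated, so
    derivatives within it are unique, also at the end points.\<close>
  have "nderiv a b r c s \<bullet> ?D + p (Suc r) = 0"
    unfolding p_def using ab s
    by (intro vector_derivative_unique_within[OF _ der der0]) (auto simp: trivial_limit_within islimpt_Icc)
  \<comment> \<open>Only the component of \<open>?D\<close> along \<open>?e r\<close> survives, as
    the derivative of order \<open>r\<close> is orthogonal to
    \<open>?e (Suc (Suc r))\<close>.\<close>
  moreover have "nderiv a b r c s \<bullet> ?D = - \<kappa> r s * p r"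
    using zero[OF s, of "Suc (Suc r)"] r by (auto simp: p_def inner_add_right inner_diff_right)
  ultimately show ?thesis
    using frame(4)[OF s r] by (simp add: p_def field_simps)
qed

theorem corollary3:
  fixes c :: "real \<Rightarrow> 'a::euclidean_space"
    and Or :: "'a list set"
    and \<kappa> :: "nat \<Rightarrow> real \<Rightarrow> real"
    and a b :: real
  assumes "DIM('a) \<ge> 2"
    and "orientation Or"
    and "regular_curve a b c"
    and "\<forall>s\<in>{a..b}. norm (nderiv a b 1 c s) = 1"
    and "frenet_curvatures Or a b c \<kappa>"
  shows "(\<forall>s\<in>{a..b}. \<forall>r\<in>{1..DIM('a) - 2}.
            \<kappa> r s = vol (derivs a b c (r - 1) s) * vol (derivs a b c (r + 1) s)
                     / (vol (derivs a b c r s))\<^sup>2) \<and>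
         (\<forall>s\<in>{a..b}.
            \<kappa> (DIM('a) - 1) s = vol (derivs a b c (DIM('a) - 2) s)
                     / (vol (derivs a b c (DIM('a) - 1) s))\<^sup>2
                     * oriented_det Or (derivs a b c (DIM('a)) s))"
proof -
  let ?n = "DIM('a)" and ?e = "frenet_frame Or a b c"
  define p where "p s i = nderiv a b i c s \<bullet> ?e i s" for s i
  note frame = frenet_frame_properties[OF assms(2,3)]
  have pos: "0 < p s i" if "s \<in> {a..b}" "i \<in> {1..<?n}" for s i
    unfolding p_def using frame(4) that by blast
  have \<kappa>: "\<kappa> r s = p s (Suc r) / p s r" if "s \<in> {a..b}" "r \<in> {1..<?n}" for s r
    unfolding p_def by (rule curvature_eq[OF assms(2-5) that])
  \<comment> \<open>The case \<open>k = 0\<close> is the empty volume 1. The bound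
    \<open>k < ?n\<close> matters: these \<open>p s i\<close> are positive, which removes the
    absolute value, whereas \<open>p s ?n\<close> may have any sign.\<close>
  have vol: "vol (derivs a b c k s) = (\<Prod>i=1..k. p s i)" if s: "s \<in> {a..b}" and k: "k < ?n" for s k
  proof -
    let ?E = "\<lambda>i. ?e i s"
    have "orthonormal (map ?E [1..<Suc k])"
      using frame(2)[OF s] k unfolding orthonormal_map_iff by simp
    then have "vol (derivs a b c k s) = \<bar>\<Prod>i=1..k. p s i\<bar>"
      unfolding derivs_def p_def using frame(3)[OF s] k by (intro vol_triangular) auto
    moreover have "0 < (\<Prod>i=1..k. p s i)" using pos[OF s] k by (intro prod_pos) auto
    ultimately show ?thesis by simp
  qed
  have det: "oriented_det Or (derivs a b c ?n s) = (\<Prod>i=1..?n. p s i)" if s: "s \<in> {a..b}" for s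
  proof -
    have "oriented_det Or (derivs a b c ?n s) = Determinant.det
        (coord_matrix (map (\<lambda>i. ?e i s) [1..<Suc ?n]) (derivs a b c ?n s))"
      by (rule oriented_det_eq[OF assms(2) frame(2,1)[OF s]]) (simp add: derivs_def)
    then show ?thesis
      unfolding derivs_def p_def using det_coord_matrix_triangular[OF frame(2,3)[OF s]] by simp
  qed
  \<comment> \<open>The products cancel to \<open>p s (Suc (Suc k)) / p s (Suc k)\<close>. Both
    claims are instances: the product up to \<open>Suc (Suc k)\<close> is a volume as long as
    \<open>Suc (Suc k) < ?n\<close>, and the oriented determinant when
    \<open>Suc (Suc k) = ?n\<close>.\<close>
  have ratio: "\<kappa> (Suc k) s = (\<Prod>i=1..k. p s i) * (\<Prod>i=1..Suc (Suc k). p s i) / (\<Prod>i=1..Suc k. p s i)\<^sup>2"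
    if s: "s \<in> {a..b}" and k: "Suc k < ?n" for s k
  proof -
    have "0 < (\<Prod>i=1..k. p s i)" "0 < p s (Suc k)"
      using pos[OF s] k by (auto intro!: prod_pos)
    then have "(\<Prod>i=1..k. p s i) \<noteq> 0" "p s (Suc k) \<noteq> 0" by linarith+
    then show ?thesis
      using \<kappa>[OF s, of "Suc k"] k by (simp add: power2_eq_square del: prod_zero_iff)
  qed
  show ?thesis
  proof (intro conjI ballI)
    fix s r assume s: "s \<in> {a..b}" and "r \<in> {1..?n - 2}"
    then obtain k where "r = Suc k" "Suc (Suc k) < ?n" by (cases r) auto
    then show "\<kappa> r s = vol (derivs a b c (r - 1) s) * vol (derivs a b c (r + 1) s)
        / (vol (derivs a b c r s))\<^sup>2"
      using ratio[OF s, of k] by (simp add: vol[OF s] del: prod.cl_ivl_Suc)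
  next
    fix s assume s: "s \<in> {a..b}"
    obtain k where k: "?n = Suc (Suc k)"
      using assms(1) by (metis Suc_le_D Suc_le_mono numeral_2_eq_2)
    then show "\<kappa> (?n - 1) s = vol (derivs a b c (?n - 2) s)
        / (vol (derivs a b c (?n - 1) s))\<^sup>2 * oriented_det Or (derivs a b c ?n s)"
      using ratio[OF s, of k] vol[OF s, of k] vol[OF s, of "Suc k"] det[OF s]
      by (simp del: prod.cl_ivl_Suc)
  qed
qed

end
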